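(* For every integer $m\ge 1$ let $C_m$ be the $m$-th code of the BCH family, i.e. the binary linear code of length $4^m$ with parity-check matrix $H_m=A(\Gamma_m)+I$, where $\Gamma_m=\mathrm{Cay}(\mathbb{F}_q^2, S_m\setminus\{0\})$, $q=2^m$ and $S_m=\{(a,a^3)\mid a\in\mathbb{F}_q\}$. Then the BCH family is of unit rate, i.e. $\lim_{m\to\infty} R(C_m)=1$.
   Context: For an integer $m\ge 1$ put $q=2^m$ and let $\mathbb{F}_q$ be the finite field with $q$ elements. For a subset $S\subseteq \mathbb{F}_q^2$ with $0\notin S$, the Cayley graph $\mathrm{Cay}(\mathbb{F}_q^2,S)$ on the additive group $\mathbb{F}_q^2$ has vertex set $\mathbb{F}_q^2$, two vertices $x,y$ being adjacent iff $x-y\in S$ (note $S=-S$ in characteristic 2). $A(\Gamma)$ denotes the adjacency matrix of $\Gamma$, here regarded over $\mathbb{F}_2$, and $I$ is the identity matrix. The code with parity-check matrix $H$ is $\{c : Hc^{T}=0\}$ over $\mathbb{F}_2$. The rate $R(C)$ of a binary linear code $C$ is its dimension divided by its length (the dimension of the ambient space). The rate of a family $\{C_m\}$ is $\lim_{m\to\infty}R(C_m)$ if this limit exists; the family is of unit rate if this limit equals $1$. *)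

theory Defs
  imports
    Complex_Main
    "HOL-Library.Z2"
    "HOL-Library.Function_Algebras"
    "HOL-Algebra.Ring"
    "Graph_Theory.Pair_Digraph"
begin

text \<open>
  Matrices over \<open>\<bbbF>\<^sub>2\<close> (type \<^typ>\<open>bit\<close>) with rows and columns indexed by arbitrary objects
  are functions \<open>'v \<Rightarrow> 'v \<Rightarrow> bit\<close>; the finite index set \<open>V\<close> is an explicit parameter.
  The space \<open>\<bbbF>\<^sub>2\<^bsup>V\<^esup>\<close> consists of the functions \<open>'v \<Rightarrow> bit\<close> vanishing outside \<open>V\<close>.
\<close>

definition scale_word :: "bit \<Rightarrow> ('v \<Rightarrow> bit) \<Rightarrow> 'v \<Rightarrow> bit" where
  "scale_word a c = (\<lambda>x. a * c x)"

global_interpretation word: vector_space "scale_word :: bit \<Rightarrow> ('v \<Rightarrow> bit) \<Rightarrow> 'v \<Rightarrow> bit"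
  by unfold_locales (auto simp: scale_word_def fun_eq_iff algebra_simps)

definition ambient_space :: "'v set \<Rightarrow> ('v \<Rightarrow> bit) set" where
  "ambient_space V = {c. \<forall>x. x \<notin> V \<longrightarrow> c x = 0}"

definition parity_check_code :: "'v set \<Rightarrow> ('v \<Rightarrow> 'v \<Rightarrow> bit) \<Rightarrow> ('v \<Rightarrow> bit) set" where
  "parity_check_code V H = {c \<in> ambient_space V. \<forall>x\<in>V. (\<Sum>y\<in>V. H x y * c y) = 0}"

lemma subspace_ambient_space: "word.subspace (ambient_space V)"
  by (auto simp: word.subspace_def ambient_space_def scale_word_def)

lemma subspace_parity_check_code: "word.subspace (parity_check_code V H)"
proof (rule word.subspaceI)
  have "(\<Sum>y\<in>V. H x y * (0 :: 'a \<Rightarrow> bit) y) = 0" for x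
    by (simp only: zero_fun_apply mult_zero_right sum.neutral_const)
  then show "0 \<in> parity_check_code V H"
    using word.subspace_0[OF subspace_ambient_space] unfolding parity_check_code_def by blast
next
  fix c d assume cd: "c \<in> parity_check_code V H" "d \<in> parity_check_code V H"
  have "(\<Sum>y\<in>V. H x y * (c + d) y) = 0" if "x \<in> V" for x
  proof -
    have "(\<Sum>y\<in>V. H x y * (c + d) y) = (\<Sum>y\<in>V. H x y * c y) + (\<Sum>y\<in>V. H x y * d y)"
      by (simp only: plus_fun_apply distrib_left sum.distrib)
    also have "(\<Sum>y\<in>V. H x y * c y) = 0"
      using cd(1) that unfolding parity_check_code_def by blast
    also have "(\<Sum>y\<in>V. H x y * d y) = 0"
      using cd(2) that unfolding parity_check_code_def by blast
    finally show ?thesis by (simp only: add_0)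
  qed
  then show "c + d \<in> parity_check_code V H"
    using cd word.subspace_add[OF subspace_ambient_space] unfolding parity_check_code_def by blast
next
  fix a c assume c: "c \<in> parity_check_code V H"
  have "(\<Sum>y\<in>V. H x y * scale_word a c y) = 0" if "x \<in> V" for x
  proof -
    have "(\<Sum>y\<in>V. H x y * scale_word a c y) = a * (\<Sum>y\<in>V. H x y * c y)"
      by (simp only: scale_word_def sum_distrib_left mult.left_commute)
    also have "(\<Sum>y\<in>V. H x y * c y) = 0"
      using c that unfolding parity_check_code_def by blast
    finally show ?thesis by (simp only: mult_zero_right)
  qed
  then show "scale_word a c \<in> parity_check_code V H"
    using c word.subspace_scale[OF subspace_ambient_space] unfolding parity_check_code_def by blast
qed

definition code_rate :: "'v set \<Rightarrow> ('v \<Rightarrow> bit) set \<Rightarrow> real" where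
  "code_rate V C = real (word.dim C) / real (card V)"

text \<open>An undirected graph is represented by its symmetric loop-free digraph.\<close>

definition cayley_graph :: "('a, 'b) monoid_scheme \<Rightarrow> 'a set \<Rightarrow> 'a pair_pre_digraph" where
  "cayley_graph G S =
     \<lparr> pverts = carrier G,
       parcs = {(x, y). x \<in> carrier G \<and> y \<in> carrier G \<and> x \<otimes>\<^bsub>G\<^esub> inv\<^bsub>G\<^esub> y \<in> S} \<rparr>"

lemma pair_graph_cayley_graph:
  assumes "group G" "finite (carrier G)" "S \<subseteq> carrier G" "\<one>\<^bsub>G\<^esub> \<notin> S"
    and inv: "\<And>s. s \<in> S \<Longrightarrow> inv\<^bsub>G\<^esub> s \<in> S"
  shows "pair_graph (cayley_graph G S)"
proof -
  interpret group G by fact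
  have "y \<otimes>\<^bsub>G\<^esub> inv\<^bsub>G\<^esub> x \<in> S"
    if "x \<in> carrier G" "y \<in> carrier G" "x \<otimes>\<^bsub>G\<^esub> inv\<^bsub>G\<^esub> y \<in> S" for x y
    using inv[OF that(3)] that(1,2) by (simp add: inv_mult_group)
  moreover have "finite {(x, y). x \<in> carrier G \<and> y \<in> carrier G \<and> x \<otimes>\<^bsub>G\<^esub> inv\<^bsub>G\<^esub> y \<in> S}"
    by (rule finite_subset[of _ "carrier G \<times> carrier G"]) (use assms(2) in auto)
  ultimately show ?thesis
    using assms(2,4)
    by unfold_locales (auto simp: cayley_graph_def symmetric_def sym_def arcs_ends_def arc_to_ends_def)
qed

definition adjacency_matrix :: "'v pair_pre_digraph \<Rightarrow> 'v \<Rightarrow> 'v \<Rightarrow> bit" where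
  "adjacency_matrix \<Gamma> x y = of_bool ((x, y) \<in> parcs \<Gamma>)"

definition identity_matrix :: "'v \<Rightarrow> 'v \<Rightarrow> bit" where
  "identity_matrix x y = of_bool (x = y)"

definition plane :: "('a, 'b) ring_scheme \<Rightarrow> ('a \<times> 'a) monoid" where
  "plane F = add_monoid F \<times>\<times> add_monoid F"

lemma card_plane: "card (carrier (plane F)) = card (carrier F) ^ 2"
  by (simp add: plane_def DirProd_def card_cartesian_product power2_eq_square)

lemma one_plane: "\<one>\<^bsub>plane F\<^esub> = (\<zero>\<^bsub>F\<^esub>, \<zero>\<^bsub>F\<^esub>)"
  by (simp add: plane_def DirProd_def)

definition bch_set :: "('a, 'b) ring_scheme \<Rightarrow> ('a \<times> 'a) set" where
  "bch_set F = {(a, a [^]\<^bsub>F\<^esub> (3::nat)) | a. a \<in> carrier F}"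

definition bch_graph :: "('a, 'b) ring_scheme \<Rightarrow> ('a \<times> 'a) pair_pre_digraph" where
  "bch_graph F = cayley_graph (plane F) (bch_set F - {\<one>\<^bsub>plane F\<^esub>})"

definition bch_code :: "('a, 'b) ring_scheme \<Rightarrow> (('a \<times> 'a) \<Rightarrow> bit) set" where
  "bch_code F = parity_check_code (carrier (plane F))
     (\<lambda>x y. adjacency_matrix (bch_graph F) x y + identity_matrix x y)"

end

(*
  With w = (x2 - y2) - (x1 - y1)^3, the matrix entry at (x, y) is 1 + w^(q-1).  In characteristic 2,
  w = (x2 + x1^3) + v + x1^2 t + x1 t^2 with t = y1 and v = y2 + y1^3, so as a function of y it is a
  combination of the monomials v^i t^j with (i, j) in D = {(0,0), (1,0), (0,1), (0,2)}.  Since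
  q - 1 = 1 + 2 + ... + 2^(m-1) and squaring is additive, w^(q-1) is a combination of the monomials
  with exponents in E_m = D + 2 D + ... + 2^(m-1) D.  Because |D + 2 D| = 14 < 16, we get
  |E_m| <= 4 * 14^(m/2).  A word c is a codeword as soon as the |E_m| sums over y of c(y) v^i t^j
  vanish in F_q, so by pigeonhole the dimension is at least 4^m - m |E_m| = (1 - o(1)) 4^m.
*)

theory Submission
  imports Defs "HOL-Algebra.Multiplicative_Group"
begin

section \<open>Exponents\<close>

text \<open>Exponent pairs (i, j) of the monomials v^i t^j that occur in w itself.\<close>

definition digits :: "(nat \<times> nat) set" where
  "digits = {(0, 0), (1, 0), (0, 1), (0, 2)}"

definition shift_add :: "nat \<times> nat \<Rightarrow> nat \<times> nat \<Rightarrow> nat \<times> nat" where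
  "shift_add d e = (fst d + 2 * fst e, snd d + 2 * snd e)"

text \<open>The recursion mirrors 2^(m+1) - 1 = 1 + 2 (2^m - 1): a new lowest digit is added and the
  rest is doubled. Coinciding sums merge in the set, which is the source of the saving over
  4^m.\<close>

fun exponents :: "nat \<Rightarrow> (nat \<times> nat) set" where
  "exponents 0 = {(0, 0)}"
| "exponents (Suc m) = case_prod shift_add ` (digits \<times> exponents m)"

lemma finite_exponents: "finite (exponents m)"
  by (induction m) (auto simp: digits_def)

text \<open>Provides the monomial for the constant 1 in 1 + w^(q-1).\<close>

lemma zero_in_exponents: "(0, 0) \<in> exponents m"
proof (induction m)
  case (Suc m)
  then have "((0, 0), (0, 0)) \<in> digits \<times> exponents m"
    by (simp add: digits_def)
  then show ?case
    by (force simp: shift_add_def)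
qed simp

text \<open>
  Two digits give only 14 values because \<open>(0, 2) + 2 (0, 0) = (0, 0) + 2 (0, 1)\<close> and
  \<open>(0, 2) + 2 (0, 1) = (0, 0) + 2 (0, 2)\<close>.
\<close>
lemma card_exponents_Suc_Suc: "card (exponents (Suc (Suc m))) \<le> 14 * card (exponents m)"
proof -
  define B where "B = case_prod shift_add ` (digits \<times> digits)"
  have "B \<subseteq> {(0, 0), (0, 1), (0, 2), (0, 3), (0, 4), (0, 5), (0, 6), (1, 0), (1, 2), (1, 4),
      (2, 0), (2, 1), (2, 2), (3, 0)}"
    unfolding B_def digits_def shift_add_def by auto
  then have "card B \<le> card {(0, 0), (0, 1), (0, 2), (0, 3), (0, 4), (0, 5), (0, 6), (1, 0), (1, 2),
      (1, 4), (2, 0), (2, 1), (2, 2), (3, 0) :: nat \<times> nat}"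
    by (rule card_mono[rotated]) simp
  then have "card B \<le> 14"
    by simp
  \<comment> \<open>Regroup d + 2 (d' + 2 e) as (d + 2 d') + 4 e. One factor 2 is inside
    \<open>shift_add\<close>, the other is the explicit doubling of \<open>e\<close>.\<close>
  have "exponents (Suc (Suc m)) \<subseteq>
      (\<lambda>(b, e). shift_add b (2 * fst e, 2 * snd e)) ` (B \<times> exponents m)"
  proof
    fix x assume "x \<in> exponents (Suc (Suc m))"
    then obtain d d' e where *: "d \<in> digits" "d' \<in> digits" "e \<in> exponents m"
      and x: "x = shift_add d (shift_add d' e)"
      by auto
    then have "(shift_add d d', e) \<in> B \<times> exponents m"
      by (auto simp: B_def)
    moreover have "x = shift_add (shift_add d d') (2 * fst e, 2 * snd e)"
      by (simp add: x shift_add_def)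
    ultimately show "x \<in> (\<lambda>(b, e). shift_add b (2 * fst e, 2 * snd e)) ` (B \<times> exponents m)"
      by (metis (no_types, lifting) image_eqI case_prod_conv)
  qed
  then have "card (exponents (Suc (Suc m))) \<le> card (B \<times> exponents m)"
    by (rule surj_card_le[rotated]) (auto simp: B_def digits_def finite_exponents)
  also have "\<dots> \<le> 14 * card (exponents m)"
    using \<open>card B \<le> 14\<close> by (simp add: card_cartesian_product)
  finally show ?thesis .
qed

text \<open>Two steps of the recursion cost a factor 14, hence sqrt 14 per step. The constant 4
  covers both base cases m = 0 and m = 1 of the induction by twos.\<close>

lemma card_exponents_le: "real (card (exponents m)) \<le> 4 * sqrt 14 ^ m"
proof (induction m rule: induct_nat_012)
  case 1
  have "exponents (Suc 0) = set [(0, 0), (1, 0), (0, 1), (0, 2)]"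
    by (auto simp: digits_def shift_add_def)
  then have "card (exponents (Suc 0)) \<le> 4"
    using card_length[of "[(0, 0), (1, 0), (0, 1), (0, 2)] :: (nat \<times> nat) list"] by simp
  moreover have "sqrt 14 \<ge> 1"
    by simp
  ultimately show ?case
    unfolding power_Suc power_0 by linarith
next
  case (ge2 m)
  have "real (card (exponents (Suc (Suc m)))) \<le> 14 * real (card (exponents m))"
    using card_exponents_Suc_Suc[of m] by linarith
  also have "\<dots> \<le> 14 * (4 * sqrt 14 ^ m)"
    using ge2 by simp
  also have "\<dots> = 4 * sqrt 14 ^ Suc (Suc m)"
    by simp
  finally show ?case .
qed simp

section \<open>Finite fields of characteristic two\<close>

locale char_two_field = field R for R (structure) +
  assumes one_add_one: "\<one> \<oplus> \<one> = \<zero>"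
begin

lemma add_self: "a \<in> carrier R \<Longrightarrow> a \<oplus> a = \<zero>"
  using l_distr[of \<one> \<one> a] one_add_one by simp

lemma minus_eq_self: "a \<in> carrier R \<Longrightarrow> \<ominus> a = a"
  by (simp add: add_self minus_equality)

lemma square_add:
  assumes "a \<in> carrier R" "b \<in> carrier R"
  shows "(a \<oplus> b) [^] (2::nat) = a [^] (2::nat) \<oplus> b [^] (2::nat)"
proof -
  have "(a \<oplus> b) [^] (2::nat) = a \<otimes> a \<oplus> (a \<otimes> b \<oplus> a \<otimes> b) \<oplus> b \<otimes> b"
    using assms by (simp add: numeral_2_eq_2 l_distr r_distr a_ac m_comm)
  then show ?thesis
    using assms by (simp add: numeral_2_eq_2 add_self)
qed

text \<open>The inclusion of the prime field. It carries binary parity sums into the field, where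
  the matrix entries become polynomials, and its injectivity brings the result back.\<close>

definition embed_bit :: "bit \<Rightarrow> 'a" where
  "embed_bit b = (if b = 0 then \<zero> else \<one>)"

lemma embed_bit_closed [simp]: "embed_bit b \<in> carrier R"
  by (simp add: embed_bit_def)

lemma embed_bit_add: "embed_bit (a + b) = embed_bit a \<oplus> embed_bit b"
  by (cases a; cases b) (simp_all add: embed_bit_def one_add_one)

lemma embed_bit_mult: "embed_bit (a * b) = embed_bit a \<otimes> embed_bit b"
  by (cases a; cases b) (simp_all add: embed_bit_def)

lemma embed_bit_sum:
  "finite A \<Longrightarrow> embed_bit (\<Sum>y\<in>A. f y) = (\<Oplus>y\<in>A. embed_bit (f y))"
proof (induction A rule: finite_induct)
  case empty
  then show ?case by (simp add: embed_bit_def)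
next
  case (insert y A)
  then show ?case
    unfolding sum.insert[OF insert.hyps] embed_bit_add by (simp add: finsum_insert)
qed

lemma embed_bit_eq_zero_iff: "embed_bit b = \<zero> \<longleftrightarrow> b = 0"
  by (simp add: embed_bit_def)

section \<open>Monomials in v and t and the functions they span\<close>

abbreviation V :: "('a \<times> 'a) set" where
  "V \<equiv> carrier R \<times> carrier R"

text \<open>The coordinate v = y2 + y1^3 absorbs the cube, so that w needs four monomials instead of
  the five in y1 and y2.\<close>

definition monomial :: "nat \<times> nat \<Rightarrow> 'a \<times> 'a \<Rightarrow> 'a" where
  "monomial e y = (snd y \<oplus> fst y [^] (3::nat)) [^] fst e \<otimes> fst y [^] snd e"

lemma monomial_closed [simp]: "y \<in> V \<Longrightarrow> monomial e y \<in> carrier R"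
  by (auto simp: monomial_def)

lemma monomial_shift_add:
  assumes "y \<in> V"
  shows "monomial d y \<otimes> monomial e y [^] (2::nat) = monomial (shift_add d e) y"
proof -
  define v t where "v = snd y \<oplus> fst y [^] (3::nat)" and "t = fst y"
  have vt: "v \<in> carrier R" "t \<in> carrier R"
    using assms by (auto simp: v_def t_def)
  have "monomial d y \<otimes> monomial e y [^] (2::nat) =
      (v [^] fst d \<otimes> t [^] snd d) \<otimes> ((v [^] fst e) [^] (2::nat) \<otimes> (t [^] snd e) [^] (2::nat))"
    using vt unfolding monomial_def v_def t_def by (simp add: nat_pow_distrib)
  also have "\<dots> = (v [^] fst d \<otimes> v [^] (2 * fst e)) \<otimes> (t [^] snd d \<otimes> t [^] (2 * snd e))"
    using vt by (simp add: nat_pow_pow m_ac mult.commute)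
  also have "\<dots> = monomial (shift_add d e) y"
    using vt unfolding monomial_def v_def t_def by (simp add: nat_pow_mult shift_add_def)
  finally show ?thesis .
qed

text \<open>Generated inductively so that additive properties follow by rule induction, without
  coefficient families. Equations are imposed on \<open>V\<close> only, leaving values elsewhere
  free.\<close>

inductive_set monomial_span :: "(nat \<times> nat) set \<Rightarrow> ('a \<times> 'a \<Rightarrow> 'a) set"
  for E :: "(nat \<times> nat) set" where
  monomial: "e \<in> E \<Longrightarrow> a \<in> carrier R \<Longrightarrow> (\<And>y. y \<in> V \<Longrightarrow> f y = a \<otimes> monomial e y)
    \<Longrightarrow> f \<in> monomial_span E"
| add: "f \<in> monomial_span E \<Longrightarrow> g \<in> monomial_span E \<Longrightarrow> (\<And>y. y \<in> V \<Longrightarrow> h y = f y \<oplus> g y)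
    \<Longrightarrow> h \<in> monomial_span E"

lemma monomial_span_closed:
  "f \<in> monomial_span E \<Longrightarrow> y \<in> V \<Longrightarrow> f y \<in> carrier R"
  by (induction rule: monomial_span.induct) auto

lemma monomial_span_cong:
  assumes "f \<in> monomial_span E" "\<And>y. y \<in> V \<Longrightarrow> g y = f y"
  shows "g \<in> monomial_span E"
  using assms(1)
proof cases
  case (monomial e a)
  then show ?thesis
    using assms(2) by (intro monomial_span.monomial[of e E a]) auto
next
  case (add f1 f2)
  then show ?thesis
    using assms(2) by (simp add: monomial_span.add[of f1 E f2])
qed

text \<open>Squaring is additive in characteristic 2, so f g^2 is additive in f and in g. Two nested
  inductions reduce it to single monomials, where the exponents combine to d + 2 e without cross
  terms.\<close>

lemma monomial_span_mult_square:
  assumes "f \<in> monomial_span D" "g \<in> monomial_span E"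
  shows "(\<lambda>y. f y \<otimes> g y [^] (2::nat)) \<in> monomial_span (case_prod shift_add ` (D \<times> E))"
    (is "_ \<in> monomial_span ?S")
  using assms(1)
proof (induction rule: monomial_span.induct)
  case (monomial d a f)
  show ?case
    using assms(2)
  proof (induction rule: monomial_span.induct)
    case (monomial e b g)
    show ?case
    proof (rule monomial_span.monomial)
      show "shift_add d e \<in> ?S"
        using \<open>d \<in> D\<close> \<open>e \<in> E\<close> by force
      show "a \<otimes> b [^] (2::nat) \<in> carrier R"
        using \<open>a \<in> carrier R\<close> \<open>b \<in> carrier R\<close> by simp
      fix y assume y: "y \<in> V"
      have "f y \<otimes> g y [^] (2::nat) =
          a \<otimes> b [^] (2::nat) \<otimes> (monomial d y \<otimes> monomial e y [^] (2::nat))"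
        using y \<open>a \<in> carrier R\<close> \<open>b \<in> carrier R\<close> \<open>\<And>y. y \<in> V \<Longrightarrow> f y = _ y\<close> \<open>\<And>y. y \<in> V \<Longrightarrow> g y = _ y\<close>
        by (simp add: nat_pow_distrib m_ac)
      then show "f y \<otimes> g y [^] (2::nat) = a \<otimes> b [^] (2::nat) \<otimes> monomial (shift_add d e) y"
        using y by (simp add: monomial_shift_add)
    qed
  next
    case (add g g' h)
    have "f y \<in> carrier R" if "y \<in> V" for y
      using monomial that by simp
    then show ?case
      using add monomial_span_closed[OF add.hyps(1)] monomial_span_closed[OF add.hyps(2)]
      by (intro monomial_span.add[OF add.IH]) (simp add: square_add r_distr)
  qed
next
  case (add f f' h)
  then show ?case
    using monomial_span_closed[OF add.hyps(1)] monomial_span_closed[OF add.hyps(2)]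
      monomial_span_closed[OF assms(2)]
    by (intro monomial_span.add[OF add.IH]) (simp add: l_distr)
qed

section \<open>The function w and its powers\<close>

definition cubic_form :: "'a \<times> 'a \<Rightarrow> 'a \<times> 'a \<Rightarrow> 'a" where
  "cubic_form x y = (snd x \<ominus> snd y) \<ominus> (fst x \<ominus> fst y) [^] (3::nat)"

lemma cubic_form_closed: "x \<in> V \<Longrightarrow> y \<in> V \<Longrightarrow> cubic_form x y \<in> carrier R"
  by (auto simp: cubic_form_def)

lemma cubic_form_in_span:
  assumes "x \<in> V"
  shows "cubic_form x \<in> monomial_span digits"
proof -
  obtain a b where x: "x = (a, b)" and ab: "a \<in> carrier R" "b \<in> carrier R"
    using assms by auto
  have expand: "cubic_form x y = (b \<oplus> a [^] (3::nat)) \<otimes> monomial (0, 0) y \<oplus>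
      (\<one> \<otimes> monomial (1, 0) y \<oplus> (a [^] (2::nat) \<otimes> monomial (0, 1) y \<oplus> a \<otimes> monomial (0, 2) y))"
    if y_in: "y \<in> V" for y
  proof -
    obtain t u where y: "y = (t, u)" and tu: "t \<in> carrier R" "u \<in> carrier R"
      using y_in by auto
    \<comment> \<open>The binomial coefficients 3 become 1 in characteristic 2. The term t^3 then
      joins u to form v.\<close>
    have "(a \<oplus> t) [^] (3::nat) = (a \<oplus> t) [^] (2::nat) \<otimes> (a \<oplus> t)"
      by (simp add: numeral_3_eq_3 numeral_2_eq_2)
    also have "\<dots> = a [^] (3::nat) \<oplus> t [^] (3::nat) \<oplus> a [^] (2::nat) \<otimes> t \<oplus> a \<otimes> t [^] (2::nat)"
      unfolding square_add[OF ab(1) tu(1)]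
      using ab tu by (simp add: l_distr r_distr numeral_3_eq_3 numeral_2_eq_2 a_ac m_ac)
    finally show ?thesis
      using ab tu
      by (simp add: x y cubic_form_def monomial_def a_minus_def minus_eq_self a_ac)
  qed
  show ?thesis
    by (rule monomial_span.add[OF monomial_span.monomial[OF _ _ refl]
          monomial_span.add[OF monomial_span.monomial[OF _ _ refl]
            monomial_span.add[OF monomial_span.monomial[OF _ _ refl]
              monomial_span.monomial[OF _ _ refl] refl] refl] expand])
      (use ab in \<open>auto simp: digits_def\<close>)
qed

lemma cubic_form_power_in_span:
  assumes "x \<in> V"
  shows "(\<lambda>y. cubic_form x y [^] (2 ^ m - 1 :: nat)) \<in> monomial_span (exponents m)"
proof (induction m)
  case 0
  \<comment> \<open>The exponent 2^0 - 1 is 0, so the power is constantly 1, even where w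
    vanishes.\<close>
  show ?case
    by (rule monomial_span.monomial[of "(0, 0)" _ \<one>]) (auto simp: monomial_def)
next
  case (Suc m)
  let ?w = "cubic_form x" and ?S = "exponents (Suc m)"
  \<comment> \<open>Split off the lowest binary digit of the exponent, all of whose digits are
    1.\<close>
  have eq: "?w y [^] (2 ^ Suc m - 1 :: nat) = ?w y \<otimes> (?w y [^] (2 ^ m - 1 :: nat)) [^] (2::nat)"
    if "y \<in> V" for y
  proof -
    have "(2::nat) ^ m > 0"
      by simp
    then have "(2::nat) ^ Suc m - 1 = Suc ((2 ^ m - 1) * 2)"
      unfolding power_Suc by linarith
    then show ?thesis
      using cubic_form_closed[OF assms that] by (simp only: nat_pow_Suc2 nat_pow_pow)
  qed
  have "(\<lambda>y. ?w y \<otimes> (?w y [^] (2 ^ m - 1 :: nat)) [^] (2::nat)) \<in> monomial_span ?S"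
    using monomial_span_mult_square[OF cubic_form_in_span[OF assms] Suc] by simp
  then show ?case
    by (rule monomial_span_cong) (rule eq)
qed

section \<open>Field-valued parity checks of binary words\<close>

definition syndrome :: "('a \<times> 'a \<Rightarrow> bit) \<Rightarrow> ('a \<times> 'a \<Rightarrow> 'a) \<Rightarrow> 'a" where
  "syndrome c f = (\<Oplus>y\<in>V. embed_bit (c y) \<otimes> f y)"

lemma syndrome_closed:
  "(\<And>y. y \<in> V \<Longrightarrow> f y \<in> carrier R) \<Longrightarrow> syndrome c f \<in> carrier R"
  unfolding syndrome_def by (rule finsum_closed) auto

lemma syndrome_add_word:
  assumes "\<And>y. y \<in> V \<Longrightarrow> f y \<in> carrier R"
  shows "syndrome (c + d) f = syndrome c f \<oplus> syndrome d f"
proof -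
  have "syndrome (c + d) f = (\<Oplus>y\<in>V. embed_bit (c y) \<otimes> f y \<oplus> embed_bit (d y) \<otimes> f y)"
    unfolding syndrome_def plus_fun_apply embed_bit_add using assms
    by (intro finsum_cong') (auto simp: l_distr)
  also have "\<dots> = syndrome c f \<oplus> syndrome d f"
    unfolding syndrome_def using assms by (intro finsum_addf) auto
  finally show ?thesis .
qed

lemma syndrome_add:
  assumes "\<And>y. y \<in> V \<Longrightarrow> f y \<in> carrier R" "\<And>y. y \<in> V \<Longrightarrow> g y \<in> carrier R"
    and "\<And>y. y \<in> V \<Longrightarrow> h y = f y \<oplus> g y"
  shows "syndrome c h = syndrome c f \<oplus> syndrome c g"
proof -
  have "syndrome c h = (\<Oplus>y\<in>V. embed_bit (c y) \<otimes> f y \<oplus> embed_bit (c y) \<otimes> g y)"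
    unfolding syndrome_def using assms by (intro finsum_cong') (auto simp: r_distr)
  also have "\<dots> = syndrome c f \<oplus> syndrome c g"
    unfolding syndrome_def using assms by (intro finsum_addf) auto
  finally show ?thesis .
qed

lemma syndrome_scale:
  assumes "finite (carrier R)" "a \<in> carrier R" "\<And>y. y \<in> V \<Longrightarrow> g y \<in> carrier R"
    and "\<And>y. y \<in> V \<Longrightarrow> f y = a \<otimes> g y"
  shows "syndrome c f = a \<otimes> syndrome c g"
proof -
  have "syndrome c f = (\<Oplus>y\<in>V. a \<otimes> (embed_bit (c y) \<otimes> g y))"
    unfolding syndrome_def using assms by (intro finsum_cong') (auto simp: m_lcomm)
  also have "\<dots> = a \<otimes> syndrome c g"
    unfolding syndrome_def using assms by (intro finsum_rdistr[symmetric]) auto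
  finally show ?thesis .
qed

text \<open>The syndrome is linear in the checking function, so vanishing on the monomials passes to
  everything they span.\<close>

lemma syndrome_eq_zero:
  assumes "finite (carrier R)" "f \<in> monomial_span E"
    and "\<And>e. e \<in> E \<Longrightarrow> syndrome c (monomial e) = \<zero>"
  shows "syndrome c f = \<zero>"
  using assms(2)
proof (induction rule: monomial_span.induct)
  case (monomial e a f)
  then have "syndrome c f = a \<otimes> syndrome c (local.monomial e)"
    using assms(1) by (intro syndrome_scale) auto
  then show ?case
    using monomial assms(3) by simp
next
  case (add f g h)
  then have "syndrome c h = syndrome c f \<oplus> syndrome c g"
    by (intro syndrome_add) (auto intro: monomial_span_closed)
  then show ?case
    using add by simp
qed

text \<open>The cubic form vanishes exactly when x - y lies on the curve of points (a, a^3). The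
  origin of the curve was removed from the connection set to avoid loops; adding the identity matrix
  restores it on the diagonal.\<close>

lemma parity_check_matrix_entry:
  assumes "x \<in> V" "y \<in> V"
  shows "adjacency_matrix (bch_graph R) x y + identity_matrix x y = of_bool (cubic_form x y = \<zero>)"
proof -
  obtain a b t u where xy: "x = (a, b)" "y = (t, u)"
    and cl: "a \<in> carrier R" "b \<in> carrier R" "t \<in> carrier R" "u \<in> carrier R"
    using assms by auto
  have eq0: "p \<ominus> r = \<zero> \<longleftrightarrow> p = r" if "p \<in> carrier R" "r \<in> carrier R" for p r
    using that by (simp add: r_right_minus_eq)
  have "x \<otimes>\<^bsub>plane R\<^esub> inv\<^bsub>plane R\<^esub> y = (a \<ominus> t, b \<ominus> u)"
    using cl by (simp add: xy plane_def inv_DirProd add.group_axioms a_minus_def a_inv_def)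
  then have "(x, y) \<in> parcs (bch_graph R) \<longleftrightarrow>
      (a \<ominus> t, b \<ominus> u) \<in> bch_set R \<and> (a \<ominus> t, b \<ominus> u) \<noteq> (\<zero>, \<zero>)"
    using cl by (simp add: bch_graph_def cayley_graph_def one_plane plane_def xy)
  also have "\<dots> \<longleftrightarrow> cubic_form x y = \<zero> \<and> x \<noteq> y"
    using cl eq0 by (auto simp: bch_set_def cubic_form_def xy)
  finally have "(x, y) \<in> parcs (bch_graph R) \<longleftrightarrow> cubic_form x y = \<zero> \<and> x \<noteq> y" .
  moreover have "cubic_form x x = \<zero>"
    using cl by (simp add: cubic_form_def xy a_minus_def r_neg numeral_3_eq_3)
  ultimately show ?thesis
    by (auto simp: adjacency_matrix_def identity_matrix_def)
qed

text \<open>Every nonzero w satisfies w^(q-1) = 1 by Lagrange in the multiplicative group, and 1 + 1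
  = 0.\<close>

lemma embed_bit_of_bool_eq_zero:
  assumes "card (carrier R) = 2 ^ m" "m \<ge> 1" "w \<in> carrier R"
  shows "embed_bit (of_bool (w = \<zero>)) = \<one> \<oplus> w [^] (2 ^ m - 1 :: nat)"
proof (cases "w = \<zero>")
  case True
  \<comment> \<open>Here m \<ge> 1 matters: the exponent must be positive, as the zeroth power of 0
    is 1.\<close>
  have "(2::nat) ^ m \<ge> 2 ^ 1"
    using assms(2) by (rule power_increasing) simp
  then have "\<zero> [^] (2 ^ m - 1 :: nat) = \<zero>"
    by (intro nat_pow_zero) simp
  then show ?thesis
    using True by (simp add: embed_bit_def)
next
  case False
  \<comment> \<open>An infinite set has \<open>card\<close> 0, which is no power of 2.\<close>
  have fin: "finite (carrier R)"
    using assms(1) by (metis card.infinite power_not_zero zero_neq_numeral)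
  have "order (mult_of R) = 2 ^ m - 1"
    using assms(1) fin by (simp add: order_mult_of order_def)
  then have "w [^] (2 ^ m - 1 :: nat) = \<one>"
    using group.pow_order_eq_1[OF field_mult_group, of w] False assms(3) by (simp add: nat_pow_mult_of)
  then show ?thesis
    using False by (simp add: embed_bit_def one_add_one)
qed

text \<open>Each row of the parity-check matrix, embedded in the field, is 1 + w^(q-1) and thus lies
  in the span of the monomials with exponents in \<open>exponents m\<close>. These monomials are
  common to all rows, so few conditions on c settle all 4^m parity checks.\<close>

lemma bch_codeI:
  assumes card: "card (carrier R) = 2 ^ m" "m \<ge> 1"
    and c: "c \<in> ambient_space V" "\<And>e. e \<in> exponents m \<Longrightarrow> syndrome c (monomial e) = \<zero>"
  shows "c \<in> bch_code R"
proof -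
  have fin: "finite (carrier R)"
    using card(1) by (metis card.infinite power_not_zero zero_neq_numeral)
  have V: "carrier (plane R) = V"
    by (simp add: plane_def)
  have "(\<Sum>y\<in>V. (adjacency_matrix (bch_graph R) x y + identity_matrix x y) * c y) = 0"
    if x: "x \<in> V" for x
  proof -
    let ?f = "\<lambda>y. \<one> \<oplus> cubic_form x y [^] (2 ^ m - 1 :: nat)"
    have "?f \<in> monomial_span (exponents m)"
    proof (rule monomial_span.add[OF _ cubic_form_power_in_span[OF x] refl])
      show "(\<lambda>_. \<one>) \<in> monomial_span (exponents m)"
        by (rule monomial_span.monomial[OF zero_in_exponents, of \<one>]) (auto simp: monomial_def)
    qed
    then have "syndrome c ?f = \<zero>"
      by (rule syndrome_eq_zero[OF fin _ c(2)])
    have "embed_bit (\<Sum>y\<in>V. (adjacency_matrix (bch_graph R) x y + identity_matrix x y) * c y) =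
        (\<Oplus>y\<in>V. embed_bit ((adjacency_matrix (bch_graph R) x y + identity_matrix x y) * c y))"
      using fin by (intro embed_bit_sum) simp
    also have "\<dots> = syndrome c ?f"
      unfolding syndrome_def
    proof (intro finsum_cong' refl)
      show "(\<lambda>y. embed_bit (c y) \<otimes> ?f y) \<in> V \<rightarrow> carrier R"
        using cubic_form_closed[OF x] by auto
    next
      fix y assume y: "y \<in> V"
      have "embed_bit (adjacency_matrix (bch_graph R) x y + identity_matrix x y) = ?f y"
        unfolding parity_check_matrix_entry[OF x y]
        using card cubic_form_closed[OF x y] by (rule embed_bit_of_bool_eq_zero)
      moreover have "?f y \<in> carrier R"
        using cubic_form_closed[OF x y] by simp
      ultimately show "embed_bit ((adjacency_matrix (bch_graph R) x y + identity_matrix x y) * c y) =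
          embed_bit (c y) \<otimes> ?f y"
        unfolding embed_bit_mult by (simp add: m_comm)
    qed
    finally show ?thesis
      using \<open>syndrome c ?f = \<zero>\<close> by (simp only: embed_bit_eq_zero_iff)
  qed
  then show ?thesis
    using c(1) unfolding bch_code_def parity_check_code_def V by blast
qed

end

text \<open>By Lagrange in the additive group, 0 = 2^m 1 = (1 + 1)^m. A field has no nilpotents
  except 0, so 1 + 1 = 0.\<close>

lemma (in field) char_two_field_of_card:
  assumes "card (carrier R) = 2 ^ m"
  shows "char_two_field R"
proof unfold_locales
  let ?b = "\<one> \<oplus> \<one>"
  have pow: "[(2 ^ k :: nat)] \<cdot> \<one> = ?b [^] k" for k
  proof (induction k)
    case (Suc k)
    have "[(2 ^ Suc k :: nat)] \<cdot> \<one> = [(2 ^ k :: nat)] \<cdot> \<one> \<oplus> [(2 ^ k :: nat)] \<cdot> \<one>"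
      by (simp add: add.nat_pow_mult mult_2)
    also have "\<dots> = ?b [^] k \<otimes> ?b"
      unfolding Suc by (simp add: r_distr)
    finally show ?case
      by simp
  qed simp
  have "[order (add_monoid R)] \<cdot> \<one> = \<zero>"
    using add.pow_order_eq_1[of \<one>] by simp
  then have "?b [^] m = \<zero>"
    using assms by (simp add: order_def pow)
  moreover have "?b [^] k \<noteq> \<zero>" if "?b \<noteq> \<zero>" for k :: nat
    by (induction k) (use that in \<open>auto simp: integral_iff\<close>)
  ultimately show "?b = \<zero>"
    by blast
qed

section \<open>Counting codewords\<close>

lemma ambient_space_eq_image:
  fixes V :: "'v set"
  shows "ambient_space V = (\<lambda>T x. of_bool (x \<in> T)) ` Pow V"
proof (intro equalityI subsetI)
  fix c :: "'v \<Rightarrow> bit" assume "c \<in> ambient_space V"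
  then have "{x. c x = 1} \<in> Pow V"
    by (auto simp: ambient_space_def)
  moreover have "c = (\<lambda>x. of_bool (x \<in> {x. c x = 1}))"
    by (auto simp: fun_eq_iff)
  ultimately show "c \<in> (\<lambda>T x. of_bool (x \<in> T)) ` Pow V"
    by blast
qed (auto simp: ambient_space_def)

lemma finite_ambient_space: "finite V \<Longrightarrow> finite (ambient_space V)"
  by (simp add: ambient_space_eq_image)

lemma card_ambient_space:
  assumes "finite V"
  shows "card (ambient_space V) = 2 ^ card V"
proof -
  have "inj_on (\<lambda>T x. of_bool (x \<in> T) :: bit) (Pow V)"
    by (intro inj_onI) (auto simp: fun_eq_iff of_bool_eq_iff)
  then show ?thesis
    using assms by (simp add: ambient_space_eq_image card_image card_Pow)
qed

text \<open>Over the two-element field a linear combination of a basis is a subset sum, and a basis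
  B has 2^|B| subsets.\<close>

lemma card_le_two_power_dim:
  assumes "finite C"
  shows "card C \<le> 2 ^ word.dim C"
proof -
  obtain B where B: "B \<subseteq> C" "C \<subseteq> word.span B" "card B = word.dim C"
    using word.basis_exists[of C] by metis
  have fin: "finite B"
    using B(1) assms by (rule finite_subset)
  have "word.span B \<subseteq> (\<lambda>T. \<Sum>v\<in>T. v) ` Pow B"
  proof
    fix c assume "c \<in> word.span B"
    then obtain u where "c = (\<Sum>v\<in>B. scale_word (u v) v)"
      using fin by (auto simp: word.span_finite)
    also have "\<dots> = (\<Sum>v\<in>{v \<in> B. u v = 1}. v)"
    proof (rule sum.mono_neutral_cong_right)
      show "\<forall>v\<in>B - {v \<in> B. u v = 1}. scale_word (u v) v = 0"
        by (auto simp: scale_word_def fun_eq_iff)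
    qed (use fin in \<open>auto simp: scale_word_def\<close>)
    finally show "c \<in> (\<lambda>T. \<Sum>v\<in>T. v) ` Pow B"
      by blast
  qed
  then have "C \<subseteq> (\<lambda>T. \<Sum>v\<in>T. v) ` Pow B"
    using B(2) by blast
  then have "card C \<le> card (Pow B)"
    using fin by (intro surj_card_le) auto
  then show ?thesis
    using fin B(3) by (simp add: card_Pow)
qed

text \<open>The unit words indexed by \<open>V\<close> span the ambient space. This gives the upper
  bound 1 on the rate.\<close>

lemma dim_le_card_length:
  assumes "finite V" "C \<subseteq> ambient_space V"
  shows "word.dim C \<le> card V"
proof -
  let ?e = "\<lambda>v x. of_bool (x = v) :: bit"
  have "C \<subseteq> word.span (?e ` V)"
  proof
    fix c assume "c \<in> C"
    then have c: "c x = 0" if "x \<notin> V" for x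
      using assms(2) that by (auto simp: ambient_space_def)
    have "c x = (\<Sum>v\<in>V. scale_word (c v) (?e v)) x" for x
    proof -
      have "(\<Sum>v\<in>V. scale_word (c v) (?e v)) x = (\<Sum>v\<in>V. scale_word (c v) (?e v) x)"
        using assms(1) by (induction V rule: finite_induct) (simp_all only: sum.empty sum.insert
            zero_fun_apply plus_fun_apply simp_thms)
      also have "\<dots> = (\<Sum>v\<in>V. if x = v then c v else 0)"
        by (intro sum.cong) (auto simp: scale_word_def)
      also have "\<dots> = c x"
        using assms(1) c by (simp add: sum.delta')
      finally show ?thesis ..
    qed
    then have "c = (\<Sum>v\<in>V. scale_word (c v) (?e v))"
      by blast
    also have "\<dots> \<in> word.span (?e ` V)"
      by (intro word.span_sum word.span_scale word.span_base) blast
    finally show "c \<in> word.span (?e ` V)" .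
  qed
  then have "word.dim C \<le> card (?e ` V)"
    using assms(1) by (intro word.dim_le_card) auto
  also have "\<dots> \<le> card V"
    using assms(1) by (rule card_image_le)
  finally show ?thesis .
qed

text \<open>Pigeonhole on the vector of monomial syndromes, which has at most q^|E_m| values: words
  sharing a value differ by codewords, so no fibre is larger than the code.\<close>

lemma (in char_two_field) two_power_le_card_bch_code:
  assumes card: "card (carrier R) = 2 ^ m" "m \<ge> 1"
  shows "2 ^ card V \<le> (2 ^ m) ^ card (exponents m) * card (bch_code R)"
proof -
  \<comment> \<open>\<open>restrict\<close> fixes the values outside \<open>exponents m\<close>, so
    the image lies in a finite extensional function space.\<close>
  define \<Phi> where "\<Phi> c = restrict (\<lambda>e. syndrome c (monomial e)) (exponents m)" for c
  let ?A = "ambient_space V"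
  have fin: "finite (carrier R)"
    using card(1) by (metis card.infinite power_not_zero zero_neq_numeral)
  have finA: "finite ?A"
    using fin by (simp add: finite_ambient_space)
  have finC: "finite (bch_code R)"
    using finA by (rule rev_finite_subset) (auto simp: bch_code_def parity_check_code_def plane_def)
  have fibre: "card {c \<in> ?A. \<Phi> c = \<Phi> d} \<le> card (bch_code R)" if d: "d \<in> ?A" for d
  proof (rule card_inj_on_le)
    \<comment> \<open>Sum and difference agree in characteristic 2, so translating by d cancels the
      common syndromes.\<close>
    show "inj_on (\<lambda>c. c + d) {c \<in> ?A. \<Phi> c = \<Phi> d}"
      by (simp add: inj_on_def)
    show "(\<lambda>c. c + d) ` {c \<in> ?A. \<Phi> c = \<Phi> d} \<subseteq> bch_code R"
    proof safe
      fix c assume c: "c \<in> ?A" "\<Phi> c = \<Phi> d"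
      show "c + d \<in> bch_code R"
      proof (rule bch_codeI[OF card])
        show "c + d \<in> ?A"
          using c(1) d by (rule word.subspace_add[OF subspace_ambient_space])
        fix e assume "e \<in> exponents m"
        then have "syndrome c (monomial e) = syndrome d (monomial e)"
          using fun_cong[OF c(2), of e] by (simp add: \<Phi>_def)
        then show "syndrome (c + d) (monomial e) = \<zero>"
          by (simp add: syndrome_add_word syndrome_closed add_self)
      qed
    qed
  qed (rule finC)
  have "\<Phi> ` ?A \<subseteq> exponents m \<rightarrow>\<^sub>E carrier R"
    by (auto simp: \<Phi>_def intro!: syndrome_closed)
  then have "card (\<Phi> ` ?A) \<le> card (exponents m \<rightarrow>\<^sub>E carrier R)"
    using fin finite_exponents by (intro card_mono finite_PiE) auto
  then have image: "card (\<Phi> ` ?A) \<le> (2 ^ m) ^ card (exponents m)"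
    using card(1) finite_exponents by (simp add: card_funcsetE)
  have "2 ^ card V = card ?A"
    using fin by (simp add: card_ambient_space)
  also have "\<dots> = (\<Sum>z\<in>\<Phi> ` ?A. card {c \<in> ?A. \<Phi> c = z})"
    using sum.image_gen[OF finA, of "\<lambda>_. 1 :: nat" \<Phi>] by simp
  also have "\<dots> \<le> (\<Sum>z\<in>\<Phi> ` ?A. card (bch_code R))"
    using fibre by (intro sum_mono) auto
  also have "\<dots> \<le> (2 ^ m) ^ card (exponents m) * card (bch_code R)"
    using image by simp
  finally show ?thesis .
qed

section \<open>Bounds on the rate and its limit\<close>

lemma code_rate_bch_code_bounds:
  assumes "field F" "card (carrier F) = 2 ^ m" "m \<ge> 1"
  shows "1 - 4 * (real m * (sqrt 14 / 4) ^ m) \<le> code_rate (carrier (plane F)) (bch_code F)"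
    and "code_rate (carrier (plane F)) (bch_code F) \<le> 1"
proof -
  interpret char_two_field F
    using assms(1,2) by (rule field.char_two_field_of_card)
  have fin: "finite (carrier F)"
    using assms(2) by (metis card.infinite power_not_zero zero_neq_numeral)
  have V: "carrier (plane F) = V" and card_V: "card V = 4 ^ m"
    using assms(2) by (simp_all add: plane_def card_cartesian_product flip: power_mult_distrib)
  have sub: "bch_code F \<subseteq> ambient_space V"
    by (auto simp: bch_code_def parity_check_code_def V)
  have finV: "finite V"
    using fin by simp
  have "word.dim (bch_code F) \<le> card V"
    using finV sub by (rule dim_le_card_length)
  then show "code_rate (carrier (plane F)) (bch_code F) \<le> 1"
    by (simp add: code_rate_def V card_V)
  have "(2::nat) ^ card V \<le> (2 ^ m) ^ card (exponents m) * card (bch_code F)"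
    using assms(2,3) by (rule two_power_le_card_bch_code)
  also have "\<dots> \<le> (2 ^ m) ^ card (exponents m) * 2 ^ word.dim (bch_code F)"
    using finite_subset[OF sub finite_ambient_space[OF finV]]
    by (intro mult_left_mono card_le_two_power_dim) auto
  also have "\<dots> = 2 ^ (m * card (exponents m) + word.dim (bch_code F))"
    by (simp add: power_add power_mult)
  \<comment> \<open>Both sides are now powers of 2, so the exponents can be compared.\<close>
  finally have "4 ^ m \<le> m * card (exponents m) + word.dim (bch_code F)"
    unfolding card_V by (rule power_le_imp_le_exp[rotated]) simp
  then have "real (4 ^ m) \<le> real (m * card (exponents m) + word.dim (bch_code F))"
    by (rule of_nat_mono)
  then have "4 ^ m - real (word.dim (bch_code F)) \<le> real m * real (card (exponents m))"
    by simp
  also have "\<dots> \<le> real m * (4 * sqrt 14 ^ m)"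
    by (intro mult_left_mono card_exponents_le) simp
  finally have "4 ^ m - real m * (4 * sqrt 14 ^ m) \<le> real (word.dim (bch_code F))"
    by simp
  then have "(4 ^ m - real m * (4 * sqrt 14 ^ m)) / 4 ^ m \<le> real (word.dim (bch_code F)) / 4 ^ m"
    by (rule divide_right_mono) simp
  then show "1 - 4 * (real m * (sqrt 14 / 4) ^ m) \<le> code_rate (carrier (plane F)) (bch_code F)"
    by (simp add: code_rate_def V card_V diff_divide_distrib power_divide mult.left_commute)
qed

theorem mainTheorem1:
  fixes F :: "nat \<Rightarrow> ('a, 'b) ring_scheme"
  assumes "\<And>m. m \<ge> 1 \<Longrightarrow> field (F m)"
    and "\<And>m. m \<ge> 1 \<Longrightarrow> card (carrier (F m)) = 2 ^ m"
  shows "(\<lambda>m. code_rate (carrier (plane (F m))) (bch_code (F m))) \<longlonglongrightarrow> 1"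
proof (rule tendsto_sandwich)
  \<comment> \<open>The saving 14 < 16 makes the ratio sqrt 14 / 4 less than 1, so the geometric
    decay beats the factor m.\<close>
  have "sqrt 14 < sqrt 16"
    by (rule real_sqrt_less_mono) simp
  then have "(\<lambda>m. real m * (sqrt 14 / 4) ^ m) \<longlonglongrightarrow> 0"
    by (intro powser_times_n_limit_0) simp
  from tendsto_diff[OF tendsto_const tendsto_mult_left[OF this]] show "(\<lambda>m. 1 - 4 * (real m * (sqrt 14 / 4) ^ m)) \<longlonglongrightarrow> 1"
    by force
  show "\<forall>\<^sub>F m in sequentially. 1 - 4 * (real m * (sqrt 14 / 4) ^ m)
      \<le> code_rate (carrier (plane (F m))) (bch_code (F m))"
    \<comment> \<open>The fields are given from m = 1 on, so the bound is stated eventually.\<close>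
    using eventually_ge_at_top[of 1]
    by eventually_elim (use assms in \<open>rule code_rate_bch_code_bounds\<close>)
  show "\<forall>\<^sub>F m in sequentially. code_rate (carrier (plane (F m))) (bch_code (F m)) \<le> 1"
    using eventually_ge_at_top[of 1]
    by eventually_elim (use assms in \<open>rule code_rate_bch_code_bounds\<close>)
qed simp

end
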